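(* Let $\mathcal{F}=\{F_i : i\in\mathbb{N}\}$ be a countable family of contraction maps on $\mathbb{R}$ such that every $F_i$ is non-decreasing. If the set of fixed points of members of $\mathcal{F}$ is bounded, then there exists a bounded invariant set for $\mathcal{F}$.
   Context: $\mathbb{R}$ carries its usual metric. A map $F:\mathbb{R}\to\mathbb{R}$ is a contraction if there is a constant $c$ with $0<c<1$ such that $|F(x)-F(y)|\le c|x-y|$ for all $x,y$. A non-empty set $E\subset \mathbb{R}$ is an invariant set for $\mathcal{F}$ if $E=\overline{\bigcup_{i=1}^\infty F_i(E)}$. *)

theory Defs
  imports "HOL-Analysis.Analysis"
begin

definition contraction_map :: "(real \<Rightarrow> real) \<Rightarrow> bool" where
  "contraction_map f \<longleftrightarrow> (\<exists>c. 0 < c \<and> c < 1 \<and> (\<forall>x y. \<bar>f x - f y\<bar> \<le> c * \<bar>x - y\<bar>))"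

definition invariant_set :: "(nat \<Rightarrow> real \<Rightarrow> real) \<Rightarrow> real set \<Rightarrow> bool" where
  "invariant_set F E \<longleftrightarrow> E \<noteq> {} \<and> E = closure (\<Union>i. F i ` E)"

end

theory Submission
  imports Defs
begin

text \<open>
  A non-decreasing contraction moves every point towards its fixed point without overshooting, so
  it maps every interval that contains its fixed point into itself. An interval \<open>{a..b}\<close> containing
  the fixed points of all members of the family is therefore mapped into itself by each of them,
  even though their contraction ratios may tend to 1 and infinitely many maps are involved.
  Being closed, \<open>{a..b}\<close> is preserved by the monotone operator
  \<open>A \<mapsto> closure (\<Union>i. F i ` A)\<close>, and Knaster--Tarski gives a fixed point of this operator among the
  subsets of \<open>{a..b}\<close>. It remains to avoid the empty set, which is the least fixed point: the
  greatest one is non-empty, because it contains every fixed point of a single map \<open>F i\<close>.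
\<close>

lemma contraction_map_has_fixed_point:
  assumes "contraction_map f"
  shows "\<exists>p. f p = p"
proof -
  obtain c where "0 < c" "c < 1" "\<forall>x y. \<bar>f x - f y\<bar> \<le> c * \<bar>x - y\<bar>"
    using assms unfolding contraction_map_def by blast
  then have "\<exists>!p. f p = p"
    by (intro banach_fix_type[where c = c]) (auto simp: dist_real_def)
  then show ?thesis by blast
qed

lemma contraction_map_nonexpansive:
  assumes "contraction_map f"
  shows "\<bar>f x - f y\<bar> \<le> \<bar>x - y\<bar>"
proof -
  obtain c where "c < 1" "\<bar>f x - f y\<bar> \<le> c * \<bar>x - y\<bar>"
    using assms unfolding contraction_map_def by blast
  moreover from this have "c * \<bar>x - y\<bar> \<le> 1 * \<bar>x - y\<bar>"
    by (intro mult_right_mono) auto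
  ultimately show ?thesis by simp
qed

text \<open>Monotonicity keeps \<open>f x\<close> on the same side of the fixed point \<open>p\<close> as \<open>x\<close>, and the contraction
  property keeps it no farther from \<open>p\<close> than \<open>x\<close>; hence \<open>f x\<close> lies between \<open>x\<close> and \<open>p\<close>.\<close>

lemma mono_contraction_preserves_interval:
  assumes "contraction_map f" "mono f" "f p = p" "p \<in> {a..b}"
  shows "f ` {a..b} \<subseteq> {a..b}"
proof
  fix y assume "y \<in> f ` {a..b}"
  then obtain x where x: "x \<in> {a..b}" "y = f x" by blast
  have dist: "\<bar>f x - p\<bar> \<le> \<bar>x - p\<bar>"
    using contraction_map_nonexpansive[OF assms(1), of x p] assms(3) by simp
  show "y \<in> {a..b}"
  proof (cases "x \<le> p")
    case True
    then have "f x \<le> p" using monoD[OF assms(2), of x p] assms(3) by simp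
    then show ?thesis using True dist x assms(4) by auto
  next
    case False
    then have "p \<le> f x" using monoD[OF assms(2), of p x] assms(3) by simp
    then show ?thesis using False dist x assms(4) by auto
  qed
qed

text \<open>Intersecting the operator with the closed set \<open>K\<close> confines its greatest fixed point to \<open>K\<close>.
  The intersection does not change the operator's value there, because the operator maps
  subsets of \<open>K\<close> to subsets of \<open>K\<close>.\<close>

lemma invariant_set_within_closed_set:
  assumes "closed K" "\<And>i. F i ` K \<subseteq> K" "p \<in> K" "F j p = p"
  shows "\<exists>E \<subseteq> K. invariant_set F E"
proof -
  define G where "G = (\<lambda>A. closure (\<Union>i. F i ` A) \<inter> K)"
  define E where "E = gfp G"
  have "mono G"
    unfolding G_def by (intro monoI Int_mono closure_mono UN_mono image_mono subset_refl)
  then have "E = G E" unfolding E_def by (rule gfp_unfold)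
  then have E: "E = closure (\<Union>i. F i ` E) \<inter> K" unfolding G_def .
  then have "E \<subseteq> K" by (rule equalityD1[THEN subset_trans]) (rule Int_lower2)
  then have "(\<Union>i. F i ` E) \<subseteq> K"
    by (intro UN_least subset_trans[OF image_mono assms(2)])
  then have "closure (\<Union>i. F i ` E) \<subseteq> K" using assms(1) by (rule closure_minimal)
  with E have "E = closure (\<Union>i. F i ` E)" by (simp only: Int_absorb2)
  moreover have "E \<noteq> {}"
  proof -
    have "p \<in> (\<Union>i. F i ` {p})"
      by (intro UN_I[of j] rev_image_eqI[of p]) (simp_all add: assms(4))
    then have "p \<in> closure (\<Union>i. F i ` {p})" by (rule subsetD[OF closure_subset])
    then have "{p} \<subseteq> G {p}" unfolding G_def using assms(3) by simp
    then have "{p} \<subseteq> E" unfolding E_def by (rule gfp_upperbound)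
    then show ?thesis by blast
  qed
  ultimately show ?thesis using \<open>E \<subseteq> K\<close> unfolding invariant_set_def by (intro exI conjI)
qed

theorem theorem2p7:
  fixes F :: "nat \<Rightarrow> real \<Rightarrow> real"
  assumes "\<And>i. contraction_map (F i)"
    and "\<And>i. mono (F i)"
    and "bounded {x. \<exists>i. F i x = x}"
  shows "\<exists>E. bounded E \<and> invariant_set F E"
proof -
  obtain a b where ab: "{x. \<exists>i. F i x = x} \<subseteq> {a..b}"
    by (rule bounded_subset_cbox_symmetric[OF assms(3), unfolded cbox_interval])
  have maps: "F i ` {a..b} \<subseteq> {a..b}" for i
  proof -
    obtain p where p: "F i p = p" using contraction_map_has_fixed_point[OF assms(1)[of i]] ..
    then have "p \<in> {a..b}" by (intro subsetD[OF ab] CollectI exI[of _ i])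
    then show ?thesis by (rule mono_contraction_preserves_interval[OF assms(1) assms(2) p])
  qed
  obtain q where q: "F 0 q = q" using contraction_map_has_fixed_point[OF assms(1)[of 0]] ..
  then have "q \<in> {a..b}" by (intro subsetD[OF ab] CollectI exI[of _ 0])
  then obtain E where E: "E \<subseteq> {a..b}" "invariant_set F E"
    using invariant_set_within_closed_set[of "{a..b}" F q 0, OF closed_atLeastAtMost maps _ q] by blast
  from bounded_closed_interval E(1) have "bounded E" by (rule bounded_subset)
  with E(2) show ?thesis by (intro exI conjI)
qed

end
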